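(* There exist an elliptic curve $E$ over $\mathbb{Q}$ of positive rank with full $2$-torsion subgroup defined over $\mathbb{Q}$ (that is, $E[2]\subset E(\mathbb{Q})$) and a Châtelet conic bundle $\phi\colon X\to E$ over $\mathbb{Q}$, not admitting a section over $\mathbb{Q}$, such that $\phi(X(\mathbb{Q}))$ contains a translate of a finite index subgroup of $E(\mathbb{Q})$.
   Context: Châtelet conic bundle over an elliptic curve: let $E$ be an elliptic curve of positive rank over a number field $k$ (here $k=\mathbb{Q}$) with a short Weierstrass equation $y^2=x^3+bx+c$, and let $\pi\colon E\to\mathbb{P}^1$, $(x,y)\mapsto x$. Let $a\in k^\times\setminus k^{\times 2}$ be square free, let $f(x)\in k[x]$ be separable, and let $Y\to\mathbb{P}^1$ be the Châtelet surface, i.e. the standard smooth projective conic bundle over $\mathbb{P}^1$ given by $u^2-av^2=f(x)w^2$. Assume the ramification locus of $Y\to\mathbb{P}^1$ (the points with singular fiber) is disjoint from the ramification (branch) locus of the double cover $\pi$. Then $X:=Y\times_{\mathbb{P}^1}E$ is smooth, and the projection $\phi\colon X\to E$ is the Châtelet conic bundle over $E$ given by $u^2-av^2=f(x)w^2$. *)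

theory Defs
  imports
    Complex_Main
    "HOL-Library.Extended_Nat"
    "HOL-Computational_Algebra.Polynomial"
    "HOL-Computational_Algebra.Squarefree"
    "HOL-Algebra.Coset"
    "HOL-Algebra.FiniteProduct"
begin

text \<open>
  Varieties over the rationals are given by their points over an arbitrary field \<open>'a\<close> of
  characteristic zero, rational coefficients being embedded by \<open>of_rat\<close>.  The instance
  \<open>'a = rat\<close> gives rational points; \<open>'a = complex\<close> gives points over an algebraically closed
  field, which are used for all geometric notions (torsion, singular fibres, branch points,
  morphisms).
\<close>

section \<open>Elliptic curves in short Weierstrass form\<close>

datatype 'a ec_point = Inf | Pt 'a 'a

definition elliptic_curve :: "rat \<Rightarrow> rat \<Rightarrow> bool" where
  "elliptic_curve b c \<longleftrightarrow> 4 * b ^ 3 + 27 * c ^ 2 \<noteq> 0"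

definition ec_points :: "rat \<Rightarrow> rat \<Rightarrow> ('a::field_char_0) ec_point set" where
  "ec_points b c = insert Inf {Pt x y |x y. y ^ 2 = x ^ 3 + of_rat b * x + of_rat c}"

definition ec_chord :: "'a::field_char_0 \<Rightarrow> 'a \<Rightarrow> 'a \<Rightarrow> 'a \<Rightarrow> 'a ec_point" where
  "ec_chord m x1 y1 x2 = (let x3 = m ^ 2 - x1 - x2 in Pt x3 (m * (x1 - x3) - y1))"

fun ec_add :: "rat \<Rightarrow> 'a::field_char_0 ec_point \<Rightarrow> 'a ec_point \<Rightarrow> 'a ec_point" where
  "ec_add b Inf Q = Q"
| "ec_add b P Inf = P"
| "ec_add b (Pt x1 y1) (Pt x2 y2) =
    (if x1 \<noteq> x2 then ec_chord ((y2 - y1) / (x2 - x1)) x1 y1 x2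
     else if y1 = - y2 then Inf
     else ec_chord ((3 * x1 ^ 2 + of_rat b) / (2 * y1)) x1 y1 x2)"

definition ec_group :: "rat \<Rightarrow> rat \<Rightarrow> ('a::field_char_0) ec_point monoid" where
  "ec_group b c = \<lparr>carrier = ec_points b c, mult = ec_add b, one = Inf\<rparr>"

text \<open>The rank of an abelian group: the maximal number of elements that are linearly
  independent over the integers.\<close>

definition int_independent :: "('g, 'm) monoid_scheme \<Rightarrow> 'g set \<Rightarrow> bool" where
  "int_independent G S \<longleftrightarrow> finite S \<and> S \<subseteq> carrier G \<and>
     (\<forall>k :: 'g \<Rightarrow> int. finprod G (\<lambda>P. P [^]\<^bsub>G\<^esub> k P) S = \<one>\<^bsub>G\<^esub> \<longrightarrow> (\<forall>P\<in>S. k P = 0))"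

definition group_rank :: "('g, 'm) monoid_scheme \<Rightarrow> enat" where
  "group_rank G = (SUP S\<in>{S. int_independent G S}. enat (card S))"

definition full_rational_two_torsion :: "rat \<Rightarrow> rat \<Rightarrow> bool" where
  "full_rational_two_torsion b c \<longleftrightarrow>
     {P \<in> carrier (ec_group b c :: complex ec_point monoid).
        P \<otimes>\<^bsub>ec_group b c\<^esub> P = \<one>\<^bsub>ec_group b c\<^esub>}
     \<subseteq> map_ec_point of_rat ` (ec_points b c :: rat ec_point set)"


section \<open>The projective line and the double cover\<close>

definition p1_class :: "'a::field_char_0 \<Rightarrow> 'a \<Rightarrow> ('a \<times> 'a) set" where
  "p1_class X Z = {(l * X, l * Z) |l. l \<noteq> 0}"

definition p1_points :: "('a::field_char_0 \<times> 'a) set set" where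
  "p1_points = {p1_class X Z |X Z. (X, Z) \<noteq> (0, 0)}"

fun ec_to_p1 :: "'a::field_char_0 ec_point \<Rightarrow> ('a \<times> 'a) set" where
  "ec_to_p1 (Pt x y) = p1_class x 1"
| "ec_to_p1 Inf = p1_class 1 0"

text \<open>As the cover has degree two, its branch points are the points with a single geometric
  preimage.\<close>

definition branch_locus :: "rat \<Rightarrow> rat \<Rightarrow> (complex \<times> complex) set set" where
  "branch_locus b c = {t \<in> p1_points. \<exists>!P. P \<in> ec_points b c \<and> ec_to_p1 P = t}"


section \<open>The Chatelet surface over the projective line\<close>

text \<open>
  Let \<open>n = \<lceil>deg f / 2\<rceil>\<close> and let \<open>F\<close> be the binary form of degree \<open>2n\<close> with \<open>F(x, 1) = f(x)\<close>.
  The surface is the zero locus of \<open>u\<^sup>2 - a v\<^sup>2 = F(X, Z) w\<^sup>2\<close> in a \<open>P\<^sup>2\<close>-bundle over \<open>P\<^sup>1\<close>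
  with homogeneous coordinates \<open>(X, Z; u, v, w)\<close>, taken modulo
  \<open>(X, Z; u, v, w) ~ (l X, l Z; m u, m v, m l\<^sup>-\<^sup>n w)\<close>.  On \<open>Z = 1\<close> this is the conic bundle
  \<open>u\<^sup>2 - a v\<^sup>2 = f(x) w\<^sup>2\<close>; on \<open>X = 1\<close> it is the usual second chart
  \<open>u\<^sup>2 - a v\<^sup>2 = z\<^sup>2\<^sup>n f(1/z) w'\<^sup>2\<close>, with gluing \<open>z = 1/x\<close>, \<open>w' = x\<^sup>n w\<close>.
\<close>

definition half_deg :: "rat poly \<Rightarrow> nat" where
  "half_deg f = (degree f + 1) div 2"

definition form_of :: "rat poly \<Rightarrow> 'a::field_char_0 \<Rightarrow> 'a \<Rightarrow> 'a" where
  "form_of f X Z = (\<Sum>i\<le>degree f. of_rat (coeff f i) * X ^ i * Z ^ (2 * half_deg f - i))"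

type_synonym 'a coords = "'a \<times> 'a \<times> 'a \<times> 'a \<times> 'a"

definition nondegenerate :: "'a::field_char_0 coords \<Rightarrow> bool" where
  "nondegenerate = (\<lambda>(X, Z, u, v, w). (X, Z) \<noteq> (0, 0) \<and> (u, v, w) \<noteq> (0, 0, 0))"

definition bundle_class :: "rat poly \<Rightarrow> 'a::field_char_0 coords \<Rightarrow> 'a coords set" where
  "bundle_class f = (\<lambda>(X, Z, u, v, w).
     {(l * X, l * Z, m * u, m * v, m * w / l ^ half_deg f) |l m. l \<noteq> 0 \<and> m \<noteq> 0})"

definition chatelet_eq :: "int \<Rightarrow> rat poly \<Rightarrow> 'a::field_char_0 coords \<Rightarrow> bool" where
  "chatelet_eq a f = (\<lambda>(X, Z, u, v, w). u ^ 2 - of_int a * v ^ 2 = form_of f X Z * w ^ 2)"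

definition surface_points :: "int \<Rightarrow> rat poly \<Rightarrow> ('a::field_char_0) coords set set" where
  "surface_points a f = {bundle_class f p |p. nondegenerate p \<and> chatelet_eq a f p}"

definition surface_to_p1 :: "'a::field_char_0 coords set \<Rightarrow> ('a \<times> 'a) set" where
  "surface_to_p1 y = (\<lambda>(X, Z, u, v, w). (X, Z)) ` y"

text \<open>A plane conic is singular if its equation and the three partial derivatives of its
  equation have a common geometric zero.\<close>

definition singular_fibre :: "int \<Rightarrow> rat poly \<Rightarrow> complex \<Rightarrow> complex \<Rightarrow> bool" where
  "singular_fibre a f X Z \<longleftrightarrow> (\<exists>u v w. (u, v, w) \<noteq> (0, 0, 0) \<and> chatelet_eq a f (X, Z, u, v, w) \<and>
     2 * u = 0 \<and> - 2 * of_int a * v = 0 \<and> - 2 * form_of f X Z * w = 0)"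

definition ramification_locus :: "int \<Rightarrow> rat poly \<Rightarrow> (complex \<times> complex) set set" where
  "ramification_locus a f = {p1_class X Z |X Z. (X, Z) \<noteq> (0, 0) \<and> singular_fibre a f X Z}"


section \<open>Chatelet conic bundles over an elliptic curve\<close>

text \<open>Separability of \<open>f\<close> is the absence of repeated roots over an algebraically closed field.\<close>

definition chatelet_data :: "rat \<Rightarrow> rat \<Rightarrow> int \<Rightarrow> rat poly \<Rightarrow> bool" where
  "chatelet_data b c a f \<longleftrightarrow>
     squarefree a \<and> (\<nexists>r::rat. r ^ 2 = of_int a) \<and>
     rsquarefree (map_poly of_rat f :: complex poly) \<and>
     ramification_locus a f \<inter> branch_locus b c = {}"

definition bundle_points ::
    "rat \<Rightarrow> rat \<Rightarrow> int \<Rightarrow> rat poly \<Rightarrow> (('a::field_char_0) ec_point \<times> 'a coords set) set" where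
  "bundle_points b c a f =
     {(P, y). P \<in> ec_points b c \<and> y \<in> surface_points a f \<and> surface_to_p1 y = ec_to_p1 P}"

definition bundle_proj :: "'a::field_char_0 ec_point \<times> 'a coords set \<Rightarrow> 'a ec_point" where
  "bundle_proj = fst"


section \<open>Sections over the rationals\<close>

text \<open>
  The curve is covered by the affine charts \<open>Z \<noteq> 0\<close>, with coordinates \<open>(x, y)\<close>, and \<open>Y \<noteq> 0\<close>,
  with coordinates \<open>(x/y, 1/y)\<close>.  The second one contains the point at infinity.
\<close>

fun chart_affine :: "complex ec_point \<Rightarrow> (complex \<times> complex) option" where
  "chart_affine (Pt x y) = Some (x, y)"
| "chart_affine Inf = None"

fun chart_inf :: "complex ec_point \<Rightarrow> (complex \<times> complex) option" where
  "chart_inf (Pt x y) = (if y = 0 then None else Some (x / y, 1 / y))"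
| "chart_inf Inf = Some (0, 0)"

text \<open>Polynomials in two variables over the rationals are elements of \<open>rat poly poly\<close>; the
  inner variable is the first coordinate.\<close>

definition eval2 :: "rat poly poly \<Rightarrow> complex \<times> complex \<Rightarrow> complex" where
  "eval2 p = (\<lambda>(s, t). poly (map_poly (\<lambda>q. poly (map_poly of_rat q) s) p) t)"

definition eval_coords :: "rat poly poly coords \<Rightarrow> complex \<times> complex \<Rightarrow> complex coords" where
  "eval_coords = (\<lambda>(A, B, U, V, W) st. (eval2 A st, eval2 B st, eval2 U st, eval2 V st, eval2 W st))"

text \<open>
  A map from the curve to the \<open>P\<^sup>2\<close>-bundle is regular at \<open>P\<close>, over the rationals, if in a chart
  around \<open>P\<close> it is given, on a Zariski neighbourhood of \<open>P\<close>, by polynomials with rational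
  coefficients in homogeneous coordinates.  The neighbourhood can be taken to be the set where
  these homogeneous coordinates are nondegenerate.
\<close>

definition regular_in_chart ::
    "rat \<Rightarrow> rat \<Rightarrow> rat poly \<Rightarrow> (complex ec_point \<Rightarrow> (complex \<times> complex) option) \<Rightarrow>
     (complex ec_point \<Rightarrow> complex coords set) \<Rightarrow> complex ec_point \<Rightarrow> bool" where
  "regular_in_chart b c f chart g P \<longleftrightarrow>
     (\<exists>A. (\<exists>st. chart P = Some st \<and> nondegenerate (eval_coords A st)) \<and>
          (\<forall>Q \<in> ec_points b c. \<forall>st. chart Q = Some st \<longrightarrow> nondegenerate (eval_coords A st) \<longrightarrow>
              g Q = bundle_class f (eval_coords A st)))"

definition regular_over_rat ::
    "rat \<Rightarrow> rat \<Rightarrow> rat poly \<Rightarrow> (complex ec_point \<Rightarrow> complex coords set) \<Rightarrow> bool" where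
  "regular_over_rat b c f g \<longleftrightarrow> (\<forall>P \<in> ec_points b c.
     regular_in_chart b c f chart_affine g P \<or> regular_in_chart b c f chart_inf g P)"

text \<open>
  A morphism to the fibre product is a pair of morphisms agreeing over \<open>P\<^sup>1\<close>.  For a section the
  component in the elliptic curve is the identity, so only the component in the surface has to
  be required to be a morphism.
\<close>

definition is_section ::
    "rat \<Rightarrow> rat \<Rightarrow> int \<Rightarrow> rat poly \<Rightarrow>
     (complex ec_point \<Rightarrow> complex ec_point \<times> complex coords set) \<Rightarrow> bool" where
  "is_section b c a f s \<longleftrightarrow>
     (\<forall>P \<in> ec_points b c. s P \<in> bundle_points b c a f \<and> bundle_proj (s P) = P) \<and>
     regular_over_rat b c f (\<lambda>P. snd (s P))"

end

theory Submission
  imports Defs "HOL-Computational_Algebra.Nth_Powers"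
begin

text \<open>
  The example is the curve \<open>y\<^sup>2 = x\<^sup>3 - 36 x\<close> with the conic bundle
  \<open>u\<^sup>2 + v\<^sup>2 = (x + 1) (x + 4) w\<^sup>2\<close>.  If the abscissa of a rational point is a square
  \<open>s\<^sup>2\<close>, its fibre has a rational point, because
  \<open>(s\<^sup>2 + 1) (s\<^sup>2 + 4) = (s\<^sup>2 - 2)\<^sup>2 + (3 s)\<^sup>2\<close> is the norm of \<open>(s + i) (s + 2 i)\<close>.
  The fibre over the rational point \<open>(-3, 9)\<close> is \<open>u\<^sup>2 + v\<^sup>2 = - 2 w\<^sup>2\<close>, which has no
  real point.  A section would lift every rational point (\<open>rational_points_of_section\<close>),
  hence there is none.

  The points with square abscissa, together with the point at infinity, form a subgroup of
  finite index.  This is the descent by the \<open>2\<close>-isogeny with kernel \<open>(0, 0)\<close>: on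
  \<open>y\<^sup>2 = x\<^sup>3 + b x\<close> the abscissas of three collinear points multiply to a square, so \<open>x\<close>
  is multiplicative modulo squares (\<open>sq_class_add\<close>), and for integral \<open>b\<close> it takes
  finitely many values there, all represented by divisors of \<open>b\<close> (\<open>sq_class_divisor\<close>).

  The same square classes show that \<open>P = (-3, 9)\<close> has infinite order.  Let \<open>N\<close> be the
  least positive number with \<open>N P = 0\<close>.  If \<open>N\<close> is odd, the class \<open>-3\<close> of \<open>P\<close> would be
  trivial.  If \<open>N = 2 M\<close>, then \<open>M P\<close> is a nonzero \<open>2\<close>-torsion point, and its class, which
  is one of \<open>-36, 6, -6\<close>, would be that of \<open>1\<close> or of \<open>-3\<close> (\<open>infinite_order\<close>).

  Associativity of the group law is avoided throughout.  Cosets and multiples of one point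
  only require \<open>(P + Q) - Q = P\<close> (\<open>ec_add_cancel\<close>), which says that the
  relation of being collinear is symmetric in the three points.
\<close>

section \<open>Chords, tangents and cancellation\<close>

text \<open>
  The line \<open>y = m x + k\<close> cuts the cubic in points with abscissas \<open>x1, x2, x3\<close>, counted with
  multiplicity.  Stating this by Vieta's formulas treats chords and tangents alike and makes
  the symmetry in the three abscissas evident.
\<close>

definition line_meets ::
    "rat \<Rightarrow> rat \<Rightarrow> 'a::field_char_0 \<Rightarrow> 'a \<Rightarrow> 'a \<Rightarrow> 'a \<Rightarrow> 'a \<Rightarrow> bool" where
  "line_meets b c m k x1 x2 x3 \<longleftrightarrow>
     x1 + x2 + x3 = m ^ 2 \<and>
     x1 * x2 + x1 * x3 + x2 * x3 = of_rat b - 2 * m * k \<and>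
     x1 * x2 * x3 = k ^ 2 - of_rat c"

lemma line_meets_on_curve:
  assumes "line_meets b c m k x1 x2 x3"
  shows "(m * x3 + k) ^ 2 = x3 ^ 3 + of_rat b * x3 + of_rat c"
proof -
  have "x3 ^ 3 + of_rat b * x3 + of_rat c - (m * x3 + k) ^ 2
      = x3 ^ 3 - m ^ 2 * x3 ^ 2 + (of_rat b - 2 * m * k) * x3 - (k ^ 2 - of_rat c)"
    by (simp add: algebra_simps power2_eq_square)
  also have "\<dots> = x3 ^ 3 - (x1 + x2 + x3) * x3 ^ 2
        + (x1 * x2 + x1 * x3 + x2 * x3) * x3 - x1 * x2 * x3"
    using assms by (simp add: line_meets_def)
  also have "\<dots> = 0" by (simp add: algebra_simps power2_eq_square power3_eq_cube)
  finally show ?thesis by simp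
qed

text \<open>
  Negation on the curve is the reflection \<open>y \<mapsto> - y\<close>, so this is the line through the
  negatives of the three points.
\<close>

lemma line_meets_reflect:
  "line_meets b c m k x1 x2 x3 \<Longrightarrow> line_meets b c (- m) (- k) x3 x2 x1"
  by (auto simp: line_meets_def algebra_simps)

lemma chord_line_meets:
  fixes x1 :: "'a::field_char_0"
  assumes x: "x1 \<noteq> x2"
    and c1: "(m * x1 + k) ^ 2 = x1 ^ 3 + of_rat b * x1 + of_rat c"
    and c2: "(m * x2 + k) ^ 2 = x2 ^ 3 + of_rat b * x2 + of_rat c"
  shows "line_meets b c m k x1 x2 (m ^ 2 - x1 - x2)"
proof -
  define B C :: 'a where BC: "B = of_rat b" "C = of_rat c"
  note c = c1[folded BC] c2[folded BC]
  have "(x1 - x2) * (x1 * x2 + x1 * (m\<^sup>2 - x1 - x2) + x2 * (m\<^sup>2 - x1 - x2) - (B - 2 * m * k)) = 0"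
    using c by algebra
  with x have e2: "x1 * x2 + x1 * (m\<^sup>2 - x1 - x2) + x2 * (m\<^sup>2 - x1 - x2) = B - 2 * m * k"
    by simp
  have e3: "x1 * x2 * (m\<^sup>2 - x1 - x2) = k ^ 2 - C"
    using c e2 by algebra
  show ?thesis using e2 e3 by (simp add: line_meets_def BC)
qed

lemma tangent_line_meets:
  fixes x :: "'a::field_char_0"
  assumes c: "(m * x + k) ^ 2 = x ^ 3 + of_rat b * x + of_rat c"
    and t: "2 * m * (m * x + k) = 3 * x ^ 2 + of_rat b"
  shows "line_meets b c m k x x (m ^ 2 - x - x)"
proof -
  define B C :: 'a where BC: "B = of_rat b" "C = of_rat c"
  note c' = c[folded BC] t[folded BC]
  have e2: "x * x + x * (m\<^sup>2 - x - x) + x * (m\<^sup>2 - x - x) = B - 2 * m * k"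
    using c' by algebra
  have e3: "x * x * (m\<^sup>2 - x - x) = k ^ 2 - C"
    using c' e2 by algebra
  show ?thesis using e2 e3 by (simp add: line_meets_def BC)
qed

text \<open>
  Closure, cancellation and the square class of a sum all follow from this description and its
  converse \<open>line_meets_ec_add\<close>, with no further case distinction on the slope.
\<close>

lemma ec_add_cases:
  fixes x1 :: "'a::field_char_0"
  assumes P: "Pt x1 y1 \<in> ec_points b c" and Q: "Pt x2 y2 \<in> ec_points b c"
  obtains (opposite) "x1 = x2" "y1 = - y2" "ec_add b (Pt x1 y1) (Pt x2 y2) = Inf"
  | (line) m k x3 where "y1 = m * x1 + k" "y2 = m * x2 + k" "line_meets b c m k x1 x2 x3"
      "ec_add b (Pt x1 y1) (Pt x2 y2) = Pt x3 (- (m * x3 + k))"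
proof -
  have c1: "y1 ^ 2 = x1 ^ 3 + of_rat b * x1 + of_rat c"
    and c2: "y2 ^ 2 = x2 ^ 3 + of_rat b * x2 + of_rat c"
    using P Q by (auto simp: ec_points_def)
  show thesis
  proof (cases "x1 = x2")
    case False
    define m k where "m = (y2 - y1) / (x2 - x1)" and "k = y1 - m * x1"
    have y1: "y1 = m * x1 + k" by (simp add: k_def)
    have y2: "y2 = m * x2 + k"
    proof -
      have "m * (x2 - x1) = y2 - y1" using False by (simp add: m_def)
      thus ?thesis by (simp add: k_def algebra_simps)
    qed
    show thesis
    proof (rule line[OF y1 y2])
      show "line_meets b c m k x1 x2 (m ^ 2 - x1 - x2)"
        using False c1 c2 y1 y2 by (intro chord_line_meets) auto
      show "ec_add b (Pt x1 y1) (Pt x2 y2) =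
          Pt (m ^ 2 - x1 - x2) (- (m * (m ^ 2 - x1 - x2) + k))"
        using False by (simp add: ec_chord_def m_def[symmetric] k_def algebra_simps)
    qed
  next
    case True
    show thesis
    proof (cases "y1 = - y2")
      case True
      with \<open>x1 = x2\<close> show thesis by (intro opposite) auto
    next
      case False
      have "y1 ^ 2 = y2 ^ 2" using c1 c2 True by simp
      hence "y1 = y2" using False by (auto simp: power2_eq_iff)
      hence y0: "y1 \<noteq> 0" using False by auto
      define m k where "m = (3 * x1 ^ 2 + of_rat b) / (2 * y1)" and "k = y1 - m * x1"
      have y1: "y1 = m * x1 + k" by (simp add: k_def)
      have y2: "y2 = m * x2 + k" using y1 \<open>y1 = y2\<close> True by simp
      have t: "2 * m * (m * x1 + k) = 3 * x1 ^ 2 + of_rat b"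
        unfolding y1[symmetric] using y0 by (simp add: m_def)
      show thesis
      proof (rule line[OF y1 y2])
        show "line_meets b c m k x1 x2 (m ^ 2 - x1 - x2)"
          using tangent_line_meets[OF c1[unfolded y1] t] True by simp
        have "ec_add b (Pt x1 y1) (Pt x2 y2) = ec_chord m x1 y1 x2"
          using False True by (simp add: m_def)
        also have "\<dots> = Pt (m ^ 2 - x1 - x2) (- (m * (m ^ 2 - x1 - x2) + k))"
          by (simp add: ec_chord_def k_def algebra_simps)
        finally show "ec_add b (Pt x1 y1) (Pt x2 y2) =
            Pt (m ^ 2 - x1 - x2) (- (m * (m ^ 2 - x1 - x2) + k))" .
      qed
    qed
  qed
qed

lemma ec_add_closed:
  assumes "P \<in> ec_points b c" "Q \<in> ec_points b c"
  shows "ec_add b P Q \<in> ec_points b c"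
proof (cases "P = Inf \<or> Q = Inf")
  case True
  thus ?thesis using assms by (cases P; cases Q) auto
next
  case False
  then obtain x1 y1 x2 y2 where PQ: "P = Pt x1 y1" "Q = Pt x2 y2"
    by (cases P; cases Q) auto
  show ?thesis
  proof (rule ec_add_cases[OF assms[unfolded PQ]])
    fix m k x3 assume l: "line_meets b c m k x1 x2 x3"
      and s: "ec_add b (Pt x1 y1) (Pt x2 y2) = Pt x3 (- (m * x3 + k))"
    have "(- (m * x3 + k)) ^ 2 = x3 ^ 3 + of_rat b * x3 + of_rat c"
      using line_meets_on_curve[OF l] by (simp only: power2_minus)
    thus ?thesis unfolding PQ s ec_points_def by blast
  qed (simp add: PQ ec_points_def)
qed

lemma ec_nonsingular:
  fixes x :: "'a::field_char_0"
  assumes "elliptic_curve b c" "x ^ 3 + of_rat b * x + of_rat c = 0"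
  shows "3 * x ^ 2 + of_rat b \<noteq> 0"
proof
  assume d: "3 * x ^ 2 + of_rat b = 0"
  have B: "of_rat b = - 3 * x ^ 2" using d by (simp add: eq_neg_iff_add_eq_0 add.commute)
  have C: "of_rat c = 2 * x ^ 3"
    using assms(2) unfolding B by algebra
  have "of_rat (4 * b ^ 3 + 27 * c ^ 2) = (0::'a)"
    unfolding of_rat_add of_rat_mult of_rat_power of_rat_numeral_eq B C by algebra
  hence "4 * b ^ 3 + 27 * c ^ 2 = 0" by (simp only: of_rat_eq_0_iff)
  with assms(1) show False by (simp add: elliptic_curve_def)
qed

lemma eq_neg_self_iff: "z = - z \<longleftrightarrow> z = 0" for z :: "'a::field_char_0"
  by (metis add.right_inverse mult_2 mult_eq_0_iff neg_0_equal_iff_equal zero_neq_numeral)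

text \<open>
  The case to exclude is a vertical tangent, \<open>x1 = x2\<close> with ordinate \<open>0\<close>, where the sum is
  \<open>Inf\<close>.  A line of finite slope that meets the curve twice at such a point would make the
  curve singular there.
\<close>

lemma line_meets_ec_add:
  fixes x1 :: "'a::field_char_0"
  assumes ec: "elliptic_curve b c" and l: "line_meets b c m k x1 x2 x3"
  shows "ec_add b (Pt x1 (m * x1 + k)) (Pt x2 (m * x2 + k)) = Pt x3 (- (m * x3 + k))"
proof -
  have x3: "x3 = m ^ 2 - x1 - x2" using l by (simp add: line_meets_def algebra_simps)
  have t: "3 * x1 ^ 2 + of_rat b = 2 * m * (m * x1 + k)" if "x1 = x2"
  proof -
    define B :: 'a where "B = of_rat b"
    have "x1 + x1 + x3 = m ^ 2" "x1 * x1 + x1 * x3 + x1 * x3 = B - 2 * m * k"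
      using l that by (auto simp: line_meets_def B_def)
    hence "3 * x1 ^ 2 + B = 2 * m * (m * x1 + k)" by algebra
    thus ?thesis by (simp add: B_def)
  qed
  show ?thesis
  proof (cases "x1 = x2")
    case False
    hence "(m * x2 + k - (m * x1 + k)) / (x2 - x1) = m" by (simp add: field_simps)
    with False show ?thesis by (simp add: ec_chord_def x3 algebra_simps)
  next
    case True
    have y: "m * x1 + k \<noteq> 0"
    proof
      assume y0: "m * x1 + k = 0"
      have "line_meets b c m k x3 x2 x1" using l by (auto simp: line_meets_def algebra_simps)
      from line_meets_on_curve[OF this] have "x1 ^ 3 + of_rat b * x1 + of_rat c = 0"
        using y0 by simp
      with ec_nonsingular[OF ec this] t[OF True] y0 show False by simp
    qed
    hence "m * x1 + k \<noteq> - (m * x2 + k)" using True eq_neg_self_iff by blast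
    moreover have "(3 * x1 ^ 2 + of_rat b) / (2 * (m * x1 + k)) = m"
      unfolding t[OF True] using y by (metis mult.assoc mult.commute mult_eq_0_iff
          nonzero_mult_div_cancel_left zero_neq_numeral)
    ultimately show ?thesis using True by (simp add: ec_chord_def x3 algebra_simps)
  qed
qed

fun ec_neg :: "'a::field_char_0 ec_point \<Rightarrow> 'a ec_point" where
  "ec_neg Inf = Inf"
| "ec_neg (Pt x y) = Pt x (- y)"

lemma ec_neg_closed: "P \<in> ec_points b c \<Longrightarrow> ec_neg P \<in> ec_points b c"
  by (cases P) (auto simp: ec_points_def)

lemma ec_neg_neg [simp]: "ec_neg (ec_neg P) = P"
  by (cases P) auto

lemma ec_add_Inf_right [simp]: "ec_add b P Inf = P"
  by (cases P) auto

lemma ec_add_neg_right [simp]: "ec_add b P (ec_neg P) = Inf"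
  by (cases P) auto

lemma ec_add_neg_left [simp]: "ec_add b (ec_neg P) P = Inf"
  by (cases P) auto

lemma ec_add_eq_Inf_iff: "ec_add b P Q = Inf \<longleftrightarrow> Q = ec_neg P"
  by (cases P; cases Q) (auto simp: ec_chord_def Let_def)

lemma ec_neg_add: "ec_neg (ec_add b P Q) = ec_add b (ec_neg P) (ec_neg Q)"
proof (cases "P = Inf \<or> Q = Inf")
  case False
  then obtain x1 y1 x2 y2 where PQ: "P = Pt x1 y1" "Q = Pt x2 y2"
    by (cases P; cases Q) auto
  have neg_chord: "ec_neg (ec_chord m x1 y1 x2) = ec_chord (- m) x1 (- y1) x2"
    for m x1 y1 x2 :: 'a
    by (simp add: ec_chord_def Let_def algebra_simps)
  have slope: "(- y2 - - y1) / (x2 - x1) = - ((y2 - y1) / (x2 - x1))"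
    by (simp add: minus_divide_left)
  have slope': "(3 * x1 ^ 2 + of_rat b) / (2 * - y1) = - ((3 * x1 ^ 2 + of_rat b) / (2 * y1))"
    by simp
  have eq: "- y1 = - (- y2) \<longleftrightarrow> y1 = - y2" by (metis minus_minus)
  show ?thesis
    unfolding PQ ec_neg.simps ec_add.simps slope slope' eq by (auto simp: neg_chord)
qed auto

text \<open>
  If \<open>P\<close>, \<open>Q\<close> and \<open>R\<close> are collinear, so are their negatives, whence
  \<open>P + Q = - R\<close> and \<open>- R + - Q = P\<close>.
\<close>

lemma ec_add_cancel:
  assumes ec: "elliptic_curve b c" and P: "P \<in> ec_points b c" and Q: "Q \<in> ec_points b c"
  shows "ec_add b (ec_add b P Q) (ec_neg Q) = P"
proof (cases "P = Inf \<or> Q = Inf")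
  case False
  then obtain x1 y1 x2 y2 where PQ: "P = Pt x1 y1" "Q = Pt x2 y2"
    by (cases P; cases Q) auto
  show ?thesis
  proof (rule ec_add_cases[OF P[unfolded PQ] Q[unfolded PQ]])
    fix m k x3 assume y: "y1 = m * x1 + k" "y2 = m * x2 + k"
      and l: "line_meets b c m k x1 x2 x3"
      and s: "ec_add b (Pt x1 y1) (Pt x2 y2) = Pt x3 (- (m * x3 + k))"
    have "ec_add b (Pt x3 (- m * x3 + - k)) (Pt x2 (- m * x2 + - k))
        = Pt x1 (- (- m * x1 + - k))"
      by (rule line_meets_ec_add[OF ec line_meets_reflect[OF l]])
    moreover have "- m * x3 + - k = - (m * x3 + k)" "- m * x2 + - k = - y2"
        "- (- m * x1 + - k) = y1"
      by (simp_all add: y)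
    ultimately show ?thesis by (simp only: PQ s ec_neg.simps)
  qed (auto simp: PQ)
qed auto

section \<open>Square classes of x-coordinates\<close>

text \<open>
  Representative of the image of a point in \<open>\<rat>\<^sup>*/\<rat>\<^sup>*\<^sup>2\<close> under the descent map of
  \<open>y\<^sup>2 = x\<^sup>3 + b x\<close>.  The value at \<open>(0, 0)\<close> must be \<open>b\<close>: a line through the origin
  meets the curve in two further points whose abscissas have product \<open>b\<close>.
\<close>

fun sq_class :: "rat \<Rightarrow> rat ec_point \<Rightarrow> rat" where
  "sq_class b Inf = 1"
| "sq_class b (Pt x y) = (if x = 0 then b else x)"

lemma sq_class_nonzero: "b \<noteq> 0 \<Longrightarrow> sq_class b P \<noteq> 0"
  by (cases P) auto

lemma sq_class_neg [simp]: "sq_class b (ec_neg P) = sq_class b P"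
  by (cases P) auto

lemma is_square_mult: "is_square x \<Longrightarrow> is_square y \<Longrightarrow> is_square (x * y)" for x y :: rat
  by (metis is_nth_power_def power_mult_distrib)

lemma is_square_cancel:
  fixes x y z :: rat
  assumes "is_square (x * y)" "is_square (y * z)" "y \<noteq> 0"
  shows "is_square (x * z)"
proof -
  obtain r s where "x * y = r ^ 2" "y * z = s ^ 2" using assms by (auto simp: is_nth_power_def)
  hence "x * z = (r * s / y) ^ 2"
    using assms(3) by (simp add: field_simps power2_eq_square)
  thus ?thesis by (auto simp: is_nth_power_def)
qed

text \<open>
  The constant term in Vieta's formulas is \<open>x1 x2 x3 = k\<^sup>2\<close> as \<open>c = 0\<close>, which settles the
  lines avoiding the origin.
\<close>

lemma sq_class_line:
  assumes b: "b \<noteq> 0" and l: "line_meets b 0 m k x1 x2 x3"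
  shows "is_square (sq_class b (Pt x1 y1) * sq_class b (Pt x2 y2) * sq_class b (Pt x3 y3))"
proof -
  have l': "x1 + x2 + x3 = m ^ 2" "x1 * x2 + x1 * x3 + x2 * x3 = b - 2 * m * k"
      "x1 * x2 * x3 = k ^ 2"
    using l by (auto simp: line_meets_def)
  show ?thesis
  proof (cases "k = 0")
    case False
    hence "x1 \<noteq> 0" "x2 \<noteq> 0" "x3 \<noteq> 0" using l'(3) by auto
    thus ?thesis using l' by (auto simp: is_nth_power_def)
  next
    case True
    \<comment> \<open>If \<open>x\<^sub>i = 0\<close>, only one summand survives in the middle formula of Vieta, so the other two
      abscissas have product \<open>b\<close>.\<close>
    hence bb: "x1 * x2 + x1 * x3 + x2 * x3 = b" using l' by simp
    have "x1 = 0 \<or> x2 = 0 \<or> x3 = 0" using l' True by simp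
    hence "sq_class b (Pt x1 y1) * sq_class b (Pt x2 y2) * sq_class b (Pt x3 y3) = b ^ 2"
      using bb b by (auto simp: power2_eq_square mult_ac)
    thus ?thesis by (auto simp: is_nth_power_def)
  qed
qed

lemma sq_class_add:
  assumes b: "b \<noteq> 0" and P: "P \<in> ec_points b 0" and Q: "Q \<in> ec_points b 0"
  shows "is_square (sq_class b P * sq_class b Q * sq_class b (ec_add b P Q))"
proof (cases "P = Inf \<or> Q = Inf")
  case True
  have "is_square (sq_class b R * sq_class b R)" for R
    by (auto simp: is_nth_power_def power2_eq_square)
  with True show ?thesis by auto
next
  case False
  then obtain x1 y1 x2 y2 where PQ: "P = Pt x1 y1" "Q = Pt x2 y2"
    by (cases P; cases Q) auto
  show ?thesis
  proof (rule ec_add_cases[OF P[unfolded PQ] Q[unfolded PQ]])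
    fix m k x3 assume "line_meets b 0 m k x1 x2 x3"
      and s: "ec_add b (Pt x1 y1) (Pt x2 y2) = Pt x3 (- (m * x3 + k))"
    thus ?thesis using sq_class_line[OF b] PQ s by simp
  qed (auto simp: PQ is_nth_power_def power2_eq_square)
qed

lemma inv_ec_group:
  assumes "P \<in> ec_points b c"
  shows "inv\<^bsub>ec_group b c\<^esub> P = ec_neg P"
  unfolding m_inv_def
proof (rule the_equality)
  show "ec_neg P \<in> carrier (ec_group b c) \<and> P \<otimes>\<^bsub>ec_group b c\<^esub> ec_neg P = \<one>\<^bsub>ec_group b c\<^esub> \<and>
      ec_neg P \<otimes>\<^bsub>ec_group b c\<^esub> P = \<one>\<^bsub>ec_group b c\<^esub>"
    using ec_neg_closed[OF assms] by (simp add: ec_group_def)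
next
  fix Q assume "Q \<in> carrier (ec_group b c) \<and> P \<otimes>\<^bsub>ec_group b c\<^esub> Q = \<one>\<^bsub>ec_group b c\<^esub> \<and>
      Q \<otimes>\<^bsub>ec_group b c\<^esub> P = \<one>\<^bsub>ec_group b c\<^esub>"
  hence "ec_add b P Q = Inf" by (simp add: ec_group_def)
  thus "Q = ec_neg P" by (simp only: ec_add_eq_Inf_iff)
qed

text \<open>The kernel of the descent map.\<close>

definition square_points :: "rat \<Rightarrow> rat ec_point set" where
  "square_points b = {P \<in> ec_points b 0. is_square (sq_class b P)}"

lemma square_points_subgroup:
  assumes b: "b \<noteq> 0"
  shows "subgroup (square_points b) (ec_group b 0)"
proof
  show "square_points b \<subseteq> carrier (ec_group b 0)"
    by (auto simp: square_points_def ec_group_def)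
  show "\<one>\<^bsub>ec_group b 0\<^esub> \<in> square_points b"
    by (auto simp: square_points_def ec_group_def ec_points_def)
next
  fix P Q assume "P \<in> square_points b" "Q \<in> square_points b"
  hence PQ: "P \<in> ec_points b 0" "Q \<in> ec_points b 0"
    and sq: "is_square (sq_class b P * sq_class b Q)"
    by (auto simp: square_points_def intro: is_square_mult)
  have "is_square (1 * (sq_class b P * sq_class b Q))" using sq by simp
  from is_square_cancel[OF this sq_class_add[OF b PQ]]
  have "is_square (sq_class b (ec_add b P Q))" using sq_class_nonzero[OF b] by simp
  thus "P \<otimes>\<^bsub>ec_group b 0\<^esub> Q \<in> square_points b"
    using ec_add_closed[OF PQ] by (simp add: square_points_def ec_group_def)
next
  fix P assume "P \<in> square_points b"
  thus "inv\<^bsub>ec_group b 0\<^esub> P \<in> square_points b"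
    by (simp add: square_points_def ec_neg_closed inv_ec_group)
qed

text \<open>
  As in a group, the cosets of the kernel are the fibres of the descent map; for the inclusion
  from right to left, \<open>A\<close> is recovered as \<open>(A - P) + P\<close>.
\<close>

lemma rcoset_square_points:
  assumes ec: "elliptic_curve b 0" and b: "b \<noteq> 0" and P: "P \<in> ec_points b 0"
  shows "square_points b #>\<^bsub>ec_group b 0\<^esub> P
    = {A \<in> ec_points b 0. is_square (sq_class b A * sq_class b P)}"
proof (intro equalityI subsetI)
  fix A assume "A \<in> square_points b #>\<^bsub>ec_group b 0\<^esub> P"
  then obtain Q where Q: "Q \<in> ec_points b 0" "is_square (sq_class b Q)" and A: "A = ec_add b Q P"
    by (auto simp: r_coset_def ec_group_def square_points_def)
  have "is_square (1 * sq_class b Q)" using Q by simp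
  moreover have "is_square (sq_class b Q * (sq_class b A * sq_class b P))"
    using sq_class_add[OF b Q(1) P] by (simp add: A mult_ac)
  ultimately have "is_square (sq_class b A * sq_class b P)"
    using is_square_cancel[of 1] sq_class_nonzero[OF b] mult_1 by metis
  thus "A \<in> {A \<in> ec_points b 0. is_square (sq_class b A * sq_class b P)}"
    using ec_add_closed[OF Q(1) P] A by simp
next
  fix A assume "A \<in> {A \<in> ec_points b 0. is_square (sq_class b A * sq_class b P)}"
  hence A: "A \<in> ec_points b 0" and sq: "is_square (1 * (sq_class b A * sq_class b P))" by auto
  define Q where "Q = ec_add b A (ec_neg P)"
  have Q: "Q \<in> ec_points b 0" unfolding Q_def by (intro ec_add_closed A ec_neg_closed P)
  have "is_square (sq_class b A * sq_class b P * sq_class b Q)"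
    using sq_class_add[OF b A ec_neg_closed[OF P]] by (simp add: Q_def)
  from is_square_cancel[OF sq this] have "is_square (sq_class b Q)"
    using sq_class_nonzero[OF b] by simp
  moreover have "ec_add b Q P = A"
    using ec_add_cancel[OF ec A ec_neg_closed[OF P]] by (simp add: Q_def)
  ultimately show "A \<in> square_points b #>\<^bsub>ec_group b 0\<^esub> P"
    using Q unfolding r_coset_def ec_group_def square_points_def by auto
qed

lemma square_of_rat_imp_square_of_int:
  assumes "is_square (of_int n :: rat)"
  shows "is_square n"
proof -
  obtain r :: rat where r: "r ^ 2 = of_int n" using assms by (auto simp: is_nth_power_def)
  obtain p q where pq: "quotient_of r = (p, q)" by (cases "quotient_of r")
  note q = quotient_of_denom_pos[OF pq] and cop = quotient_of_coprime[OF pq]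
  have "of_int (p ^ 2) = (of_int (n * q ^ 2) :: rat)"
    using r q by (simp add: quotient_of_div[OF pq] field_simps)
  hence e: "p ^ 2 = n * q ^ 2" by (simp only: of_int_eq_iff)
  hence "q ^ 2 dvd p ^ 2" by simp
  moreover have "coprime (p ^ 2) (q ^ 2)" using cop by simp
  ultimately have "is_unit (q ^ 2)" by (meson coprime_common_divisor dvd_refl)
  with q have "q = 1" by (simp add: power2_eq_1_iff)
  with e show ?thesis by (auto simp: is_nth_power_def)
qed

lemma squarefree_dvd_of_dvd_square:
  fixes d w :: int
  assumes "squarefree d" "d dvd w ^ 2"
  shows "d dvd w"
proof (cases "w = 0")
  case False
  have d0: "d \<noteq> 0" using assms(1) by auto
  show ?thesis
  proof (rule multiplicity_le_imp_dvd[OF d0])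
    fix p :: int assume p: "prime p"
    have "multiplicity p d \<le> multiplicity p (w ^ 2)"
      using assms(2) False by (intro dvd_imp_multiplicity_le) auto
    also have "\<dots> = 2 * multiplicity p w"
      using p False by (intro prime_elem_multiplicity_power_distrib) auto
    finally have "multiplicity p d \<le> 2 * multiplicity p w" .
    moreover have "multiplicity p d \<le> 1"
      using assms(1) p d0 by (simp add: squarefree_factorial_semiring'')
    ultimately show "multiplicity p d \<le> multiplicity p w" by linarith
  qed
qed simp

text \<open>
  For \<open>x = p / q\<close> in lowest terms the class of \<open>x\<close> is that of the squarefree part \<open>d\<close> of
  \<open>p q\<close>.  The equation of the curve makes \<open>d (p\<^sup>2 + B q\<^sup>2)\<close> a square, and as \<open>d\<close> is squarefree
  it divides \<open>p\<^sup>2 + B q\<^sup>2\<close>.  Coprimality of \<open>p\<close> and \<open>q\<close> then forces \<open>d\<close> to divide \<open>p\<close>, hence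
  \<open>B q\<^sup>2\<close>, hence \<open>B\<close>.
\<close>

lemma sq_class_divisor:
  fixes B :: int
  assumes B: "B \<noteq> 0" and P: "P \<in> ec_points (of_int B) 0"
  shows "\<exists>d. d dvd B \<and> is_square (sq_class (of_int B) P * of_int d)"
proof (cases P)
  case Inf
  thus ?thesis by (intro exI[of _ 1]) simp
next
  case (Pt x y)
  hence curve: "y ^ 2 = x ^ 3 + of_int B * x" using P by (simp add: ec_points_def)
  show ?thesis
  proof (cases "x = 0")
    case True
    thus ?thesis using Pt by (intro exI[of _ B]) (auto simp: is_nth_power_def power2_eq_square)
  next
    case False
    obtain p q where pq: "quotient_of x = (p, q)" by (cases "quotient_of x")
    note q = quotient_of_denom_pos[OF pq] and cop = quotient_of_coprime[OF pq]
      and x = quotient_of_div[OF pq]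
    have "p \<noteq> 0" using False x by auto
    define d s where "d = squarefree_part (p * q)" and "s = square_part (p * q)"
    have ds: "p * q = d * s ^ 2" unfolding d_def s_def by (rule squarefree_decompose)
    have s0: "s \<noteq> 0" using \<open>p \<noteq> 0\<close> q by (simp add: s_def)
    have sqf: "squarefree d" by (simp add: d_def)
    define M where "M = p ^ 2 + B * q ^ 2"
    have xq: "x * of_int q = of_int p" using q by (simp add: x)
    have "(y * of_int q ^ 2) ^ 2 = (x ^ 3 + of_int B * x) * (of_int q ^ 2) ^ 2"
      by (simp add: power_mult_distrib curve)
    also have "\<dots> = (x * of_int q) ^ 3 * of_int q + of_int B * (x * of_int q) * of_int q ^ 3"
      by (simp add: algebra_simps power2_eq_square power3_eq_cube)
    also have "\<dots> = of_int (p * q * M)"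
      unfolding xq by (simp add: M_def algebra_simps power2_eq_square power3_eq_cube)
    finally have "(y * of_int q ^ 2 / of_int s) ^ 2 = of_int (p * q * M) / of_int s ^ 2"
      by (simp add: power_divide)
    also have "\<dots> = of_int (d * M)" using s0 by (simp add: ds)
    finally have "is_square (of_int (d * M) :: rat)" by (metis is_nth_power_def)
    then obtain w where w: "d * M = w ^ 2"
      using square_of_rat_imp_square_of_int unfolding is_nth_power_def by blast
    have "d dvd w" using sqf by (rule squarefree_dvd_of_dvd_square) (simp flip: w)
    hence "d ^ 2 dvd d * M" unfolding w by (rule dvd_power_same)
    moreover have "d \<noteq> 0" using sqf by auto
    ultimately have dM: "d dvd M" by (simp add: power2_eq_square)
    have "coprime d q"
    proof (rule coprimeI)
      fix g assume g: "g dvd d" "g dvd q"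
      hence "g dvd p ^ 2 + B * q ^ 2" using dM unfolding M_def by (blast intro: dvd_trans)
      moreover have "g dvd B * q ^ 2" using g(2) by (simp add: power2_eq_square)
      ultimately have "g dvd p ^ 2" by (simp add: dvd_add_left_iff)
      moreover have "coprime (p ^ 2) q" using cop by simp
      ultimately show "is_unit g" using g(2) by (meson coprime_common_divisor)
    qed
    moreover have "d dvd p * q" by (simp add: ds)
    ultimately have "d dvd p" by (simp add: coprime_dvd_mult_left_iff)
    hence "d dvd B * q ^ 2" using dM unfolding M_def
      by (simp add: power2_eq_square dvd_add_right_iff)
    hence "d dvd B" using \<open>coprime d q\<close> by (simp add: coprime_dvd_mult_left_iff)
    moreover have "sq_class (of_int B) P * of_int d = (of_int (d * s) / of_int q) ^ 2"
    proof -
      have "x * of_int q ^ 2 = of_int (p * q)" using q by (simp add: x power2_eq_square)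
      hence "x * of_int q ^ 2 = of_int d * of_int s ^ 2" by (simp add: ds)
      thus ?thesis using Pt False q by (simp add: field_simps power2_eq_square)
    qed
    ultimately show ?thesis by (auto simp: is_nth_power_def)
  qed
qed

lemma finite_rcosets_square_points:
  fixes B :: int
  assumes ec: "elliptic_curve (of_int B) 0" and B: "B \<noteq> 0"
  shows "finite (rcosets\<^bsub>ec_group (of_int B) 0\<^esub> (square_points (of_int B)))"
proof -
  let ?b = "of_int B :: rat"
  have b: "?b \<noteq> 0" using B by simp
  define K where "K = (\<lambda>d::int. {A \<in> ec_points ?b 0. is_square (sq_class ?b A * of_int d)})"
  have "rcosets\<^bsub>ec_group ?b 0\<^esub> (square_points ?b) \<subseteq> K ` {d. d dvd B}"
  proof
    fix C assume "C \<in> rcosets\<^bsub>ec_group ?b 0\<^esub> (square_points ?b)"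
    then obtain P where P: "P \<in> ec_points ?b 0"
      and C: "C = square_points ?b #>\<^bsub>ec_group ?b 0\<^esub> P"
      by (auto simp: RCOSETS_def ec_group_def)
    obtain d where d: "d dvd B" "is_square (sq_class ?b P * of_int d)"
      using sq_class_divisor[OF B P] by blast
    have "of_int d \<noteq> (0::rat)" using d(1) B by auto
    hence "is_square (sq_class ?b A * sq_class ?b P) \<longleftrightarrow> is_square (sq_class ?b A * of_int d)" for A
      using is_square_cancel[of "sq_class ?b A" "sq_class ?b P" "of_int d"]
        is_square_cancel[of "sq_class ?b A" "of_int d" "sq_class ?b P"]
        d(2) sq_class_nonzero[OF b, of P] by (auto simp: mult.commute[of "of_int d"])
    hence "C = K d" unfolding C rcoset_square_points[OF ec b P] K_def by blast
    thus "C \<in> K ` {d. d dvd B}" using d(1) by blast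
  qed
  moreover have "finite {d. d dvd B}" using B by simp
  ultimately show ?thesis by (meson finite_imageI finite_subset)
qed

section \<open>Points of infinite order\<close>

lemma ec_pow_closed: "P \<in> ec_points b c \<Longrightarrow> P [^]\<^bsub>ec_group b c\<^esub> (n::nat) \<in> ec_points b c"
proof (induction n)
  case 0
  thus ?case by (simp add: ec_group_def ec_points_def)
next
  case (Suc n)
  thus ?case using ec_add_closed by (simp add: ec_group_def)
qed

lemma sq_class_pow:
  assumes b: "b \<noteq> 0" and P: "P \<in> ec_points b 0"
  shows "is_square (sq_class b (P [^]\<^bsub>ec_group b 0\<^esub> (n::nat)) * sq_class b P ^ n)"
proof (induction n)
  case 0
  thus ?case by (simp add: ec_group_def)
next
  case (Suc n)
  let ?Q = "P [^]\<^bsub>ec_group b 0\<^esub> n"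
  have S: "P [^]\<^bsub>ec_group b 0\<^esub> Suc n = ec_add b ?Q P" by (simp add: ec_group_def)
  have "is_square ((sq_class b P ^ n * sq_class b P * sq_class b P) * sq_class b ?Q)"
    using is_square_mult[OF Suc.IH is_nth_power_nth_power[of 2 "sq_class b P"]]
    by (simp add: power2_eq_square mult_ac)
  hence "is_square (sq_class b P ^ n * (sq_class b ?Q * sq_class b P * sq_class b P))"
    by (simp add: mult_ac)
  hence "is_square (sq_class b P * sq_class b P ^ n * (sq_class b ?Q * sq_class b P))"
    by (simp add: mult_ac)
  from is_square_cancel[OF this sq_class_add[OF b ec_pow_closed[OF P] P]]
  show ?case unfolding S using sq_class_nonzero[OF b] by (simp add: mult_ac)
qed

text \<open>
  With associativity this would be a computation in the cyclic group; here one copy of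
  \<open>P\<close> is cancelled at a time.
\<close>

lemma ec_pow_reflect:
  assumes ec: "elliptic_curve b c" and P: "P \<in> ec_points b c"
    and N: "P [^]\<^bsub>ec_group b c\<^esub> (N::nat) = Inf"
  shows "j \<le> N \<Longrightarrow> P [^]\<^bsub>ec_group b c\<^esub> (N - j) = ec_neg (P [^]\<^bsub>ec_group b c\<^esub> j)"
proof (induction j)
  case 0
  thus ?case using N by (simp add: ec_group_def)
next
  case (Suc j)
  let ?pow = "\<lambda>n::nat. P [^]\<^bsub>ec_group b c\<^esub> n"
  have S: "?pow (Suc n) = ec_add b (?pow n) P" for n by (simp add: ec_group_def)
  have "ec_add b (?pow (N - Suc j)) P = ec_neg (?pow j)"
    using Suc by (simp add: Suc_diff_Suc flip: S)
  hence "?pow (N - Suc j) = ec_add b (ec_neg (?pow j)) (ec_neg P)"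
    using ec_add_cancel[OF ec ec_pow_closed[OF P] P] by metis
  thus ?case unfolding S ec_neg_add .
qed

text \<open>
  A relation \<open>N P = 0\<close> of even minimal length \<open>N = 2 M\<close> makes \<open>M P\<close> equal to its negative by
  \<open>ec_pow_reflect\<close>, so the square classes need to be compared at the \<open>2\<close>-torsion points only.
\<close>

lemma infinite_order:
  assumes ec: "elliptic_curve b 0" and b: "b \<noteq> 0" and P: "P \<in> ec_points b 0"
    and nsq: "\<not> is_square (sq_class b P)"
    and two: "\<And>T. T \<in> ec_points b 0 \<Longrightarrow> T = ec_neg T \<Longrightarrow> T \<noteq> Inf \<Longrightarrow>
      \<not> is_square (sq_class b T) \<and> \<not> is_square (sq_class b T * sq_class b P)"
    and n: "n > (0::nat)"
  shows "P [^]\<^bsub>ec_group b 0\<^esub> n \<noteq> Inf"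
proof
  let ?pow = "\<lambda>n::nat. P [^]\<^bsub>ec_group b 0\<^esub> n"
  assume "?pow n = Inf"
  define N where "N = (LEAST n. n > 0 \<and> ?pow n = Inf)"
  have N: "N > 0" "?pow N = Inf"
    using LeastI[of "\<lambda>n. n > 0 \<and> ?pow n = Inf" n] n \<open>?pow n = Inf\<close> by (auto simp: N_def)
  have min: "?pow j \<noteq> Inf" if "0 < j" "j < N" for j
    using not_less_Least[of j "\<lambda>n. n > 0 \<and> ?pow n = Inf"] that by (auto simp: N_def)
  have parity: "is_square (sq_class b (?pow j) * (if even j then 1 else sq_class b P))" for j
  proof -
    let ?s = "sq_class b P"
    have sq: "is_square (?s ^ j * (if even j then 1 else ?s))"
    proof (cases "even j")
      case True
      then obtain i where "j = 2 * i" by auto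
      hence "?s ^ j * 1 = (?s ^ i) ^ 2" by (simp add: mult.commute flip: power_mult)
      with True show ?thesis by (metis is_nth_power_def)
    next
      case False
      then obtain i where "j = 2 * i + 1" by (auto elim: oddE)
      hence "?s ^ j * ?s = ?s ^ ((i + 1) * 2)" by (simp add: mult.commute)
      hence "?s ^ j * ?s = (?s ^ (i + 1)) ^ 2" by (simp only: power_mult)
      with False show ?thesis by (metis is_nth_power_def)
    qed
    show ?thesis
      using is_square_cancel[OF sq_class_pow[OF b P] sq] sq_class_nonzero[OF b] by simp
  qed
  show False
  proof (cases "even N")
    case False
    thus False using parity[of N] N nsq by simp
  next
    case True
    then obtain M where M: "N = 2 * M" by auto
    have "?pow M = ec_neg (?pow M)"
      using ec_pow_reflect[OF ec P N(2), of M] M by simp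
    moreover have "?pow M \<noteq> Inf" using min[of M] M N(1) by simp
    ultimately have "\<not> is_square (sq_class b (?pow M))"
        "\<not> is_square (sq_class b (?pow M) * sq_class b P)"
      using two[OF ec_pow_closed[OF P]] by auto
    thus False using parity[of M] by (auto split: if_splits)
  qed
qed

lemma group_rank_positive:
  fixes P :: "'a::field_char_0 ec_point"
  assumes P: "P \<in> ec_points b c" and ord: "\<And>n::nat. n > 0 \<Longrightarrow> P [^]\<^bsub>ec_group b c\<^esub> n \<noteq> Inf"
  shows "group_rank (ec_group b c :: 'a ec_point monoid) > 0"
proof -
  let ?G = "ec_group b c :: 'a ec_point monoid"
  have pow: "P [^]\<^bsub>?G\<^esub> k \<in> ec_points b c \<and> (P [^]\<^bsub>?G\<^esub> k = Inf \<longrightarrow> k = 0)" for k :: int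
  proof (cases "k < 0")
    case True
    let ?Q = "P [^]\<^bsub>?G\<^esub> nat (- k)"
    have "P [^]\<^bsub>?G\<^esub> k = ec_neg ?Q"
      using True inv_ec_group[OF ec_pow_closed[OF P]] by (simp add: int_pow_def nat_pow_def)
    moreover have "?Q \<noteq> Inf" using ord[of "nat (- k)"] True by linarith
    ultimately show ?thesis
      using ec_neg_closed[OF ec_pow_closed[OF P]] by (metis ec_neg.simps(1) ec_neg_neg)
  next
    case False
    have "P [^]\<^bsub>?G\<^esub> k = P [^]\<^bsub>?G\<^esub> nat k"
      using False by (simp add: int_pow_def nat_pow_def)
    moreover have "P [^]\<^bsub>?G\<^esub> nat k = Inf \<longrightarrow> k = 0"
      using ord[of "nat k"] False by (metis linorder_neqE_linordered_idom zero_less_nat_eq)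
    ultimately show ?thesis using ec_pow_closed[OF P, of "nat k"] by (simp only:)
  qed
  \<comment> \<open>\<open>finprod_insert\<close> presupposes a commutative monoid, but over a singleton the fold can be
    computed from its definition.\<close>
  have fold: "finprod ?G (\<lambda>Q. Q [^]\<^bsub>?G\<^esub> k Q) {P} = P [^]\<^bsub>?G\<^esub> k P"
    for k :: "'a ec_point \<Rightarrow> int"
  proof -
    let ?f = "(\<otimes>\<^bsub>?G\<^esub>) \<circ> (\<lambda>Q. Q [^]\<^bsub>?G\<^esub> k Q)"
    have "foldD (ec_points b c) ?f Inf {P} = P [^]\<^bsub>?G\<^esub> k P"
      unfolding foldD_def
    proof (rule the_equality)
      have "Inf \<in> ec_points b c" by (simp add: ec_points_def)
      moreover have "?f P Inf \<in> ec_points b c" using pow[of "k P"] by (simp add: ec_group_def)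
      ultimately have "({P}, ?f P Inf) \<in> foldSetD (ec_points b c) ?f Inf"
        by (intro foldSetD.intros) auto
      thus "({P}, P [^]\<^bsub>?G\<^esub> k P) \<in> foldSetD (ec_points b c) ?f Inf" by (simp add: ec_group_def)
    next
      fix z assume "({P}, z) \<in> foldSetD (ec_points b c) ?f Inf"
      thus "z = P [^]\<^bsub>?G\<^esub> k P"
      proof cases
        case (insertI x A y)
        hence A: "A = {}" and x: "x = P" by auto
        have "y = Inf" using insertI(5) unfolding A by (rule empty_foldSetDE)
        thus ?thesis using insertI(2) x by (simp add: ec_group_def)
      qed simp
    qed
    thus ?thesis by (simp add: finprod_def ec_group_def)
  qed
  have "int_independent ?G {P}"
    using P pow fold by (auto simp: int_independent_def ec_group_def)
  hence "enat (card {P}) \<le> group_rank ?G"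
    unfolding group_rank_def by (intro SUP_upper) simp
  moreover have "(0::enat) < enat (card {P})" by (simp add: zero_enat_def)
  ultimately show ?thesis by (rule less_le_trans[rotated])
qed

section \<open>Sections and rational points of the fibres\<close>

lemma p1_class_eq_iff:
  fixes X :: "'a::field_char_0"
  assumes "(X, Z) \<noteq> (0, 0)" "(X', Z') \<noteq> (0, 0)"
  shows "p1_class X Z = p1_class X' Z' \<longleftrightarrow> X * Z' = X' * Z"
proof
  assume "p1_class X Z = p1_class X' Z'"
  moreover have "(X, Z) \<in> p1_class X Z" by (auto simp: p1_class_def intro!: exI[of _ 1])
  ultimately obtain l where "X = l * X'" "Z = l * Z'" by (auto simp: p1_class_def)
  thus "X * Z' = X' * Z" by simp
next
  assume e: "X * Z' = X' * Z"
  have "\<exists>l. l \<noteq> 0 \<and> X' = l * X \<and> Z' = l * Z"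
  proof (cases "X = 0")
    case True
    hence "Z \<noteq> 0" "X' = 0" "Z' \<noteq> 0" using assms e by auto
    thus ?thesis using True by (intro exI[of _ "Z' / Z"]) auto
  next
    case False
    hence "X' \<noteq> 0" using assms e by auto
    thus ?thesis using False e by (intro exI[of _ "X' / X"]) (auto simp: field_simps)
  qed
  then obtain l where l: "l \<noteq> 0" "X' = l * X" "Z' = l * Z" by blast
  show "p1_class X Z = p1_class X' Z'"
  proof (intro equalityI subsetI)
    fix q assume "q \<in> p1_class X Z"
    then obtain k where "k \<noteq> 0" "q = (k * X, k * Z)" by (auto simp: p1_class_def)
    thus "q \<in> p1_class X' Z'"
      using l by (auto simp: p1_class_def intro!: exI[of _ "k / l"])
  next
    fix q assume "q \<in> p1_class X' Z'"
    then obtain k where "k \<noteq> 0" "q = (k * X', k * Z')" by (auto simp: p1_class_def)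
    thus "q \<in> p1_class X Z"
      using l by (auto simp: p1_class_def intro!: exI[of _ "k * l"])
  qed
qed

text \<open>
  The homogenisation has even degree \<open>2 n\<close>, and this matches the weight \<open>- n\<close> of \<open>w\<close> in
  the equation of the surface.
\<close>

lemma form_of_scale: "form_of f (l * X) (l * Z) = l ^ (2 * half_deg f) * form_of f X Z"
proof -
  have "of_rat (coeff f i) * (l * X) ^ i * (l * Z) ^ (2 * half_deg f - i)
      = l ^ (2 * half_deg f) * (of_rat (coeff f i) * X ^ i * Z ^ (2 * half_deg f - i))"
    if "i \<le> degree f" for i
  proof -
    have "i \<le> 2 * half_deg f" using that by (simp add: half_deg_def)
    hence "l ^ (2 * half_deg f) = l ^ i * l ^ (2 * half_deg f - i)"
      by (simp flip: power_add)
    thus ?thesis by (simp add: power_mult_distrib mult_ac)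
  qed
  thus ?thesis unfolding form_of_def sum_distrib_left by (intro sum.cong) auto
qed

lemma chatelet_eq_bundle_class:
  fixes p q :: "'a::field_char_0 coords"
  assumes q: "q \<in> bundle_class f p" and p: "chatelet_eq a f p"
  shows "chatelet_eq a f q"
proof -
  obtain X Z u v w where pc: "p = (X, Z, u, v, w)" by (cases p) auto
  then obtain l m where lm: "l \<noteq> 0"
    and qc: "q = (l * X, l * Z, m * u, m * v, m * w / l ^ half_deg f)"
    using q by (auto simp: bundle_class_def)
  have "l ^ (2 * half_deg f) * (m * w / l ^ half_deg f) ^ 2 = (m * w) ^ 2"
    using lm by (simp add: power_divide power_mult mult.commute[of 2])
  hence "form_of f (l * X) (l * Z) * (m * w / l ^ half_deg f) ^ 2 = m ^ 2 * (form_of f X Z * w ^ 2)"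
    unfolding form_of_scale by (simp add: power_mult_distrib algebra_simps)
  also have "\<dots> = m ^ 2 * (u ^ 2 - of_int a * v ^ 2)"
    using p by (simp add: chatelet_eq_def pc)
  also have "\<dots> = (m * u) ^ 2 - of_int a * (m * v) ^ 2"
    by (simp add: algebra_simps power_mult_distrib)
  finally show ?thesis by (simp add: chatelet_eq_def qc)
qed

lemma mem_bundle_class: "p \<in> bundle_class f p"
  by (cases p) (auto simp: bundle_class_def intro!: exI[of _ 1])

lemma surface_to_p1_bundle_class:
  "surface_to_p1 (bundle_class f (X, Z, u, v, w)) = p1_class X Z"
  by (force simp: surface_to_p1_def bundle_class_def p1_class_def)

lemma bundle_projI:
  assumes "P \<in> ec_points b c" "nondegenerate (X, Z, u, v, w)" "chatelet_eq a f (X, Z, u, v, w)"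
    and "p1_class X Z = ec_to_p1 P"
  shows "P \<in> bundle_proj ` bundle_points b c a f"
proof -
  have "(P, bundle_class f (X, Z, u, v, w)) \<in> bundle_points b c a f"
    using assms unfolding bundle_points_def surface_points_def
    by (simp add: surface_to_p1_bundle_class) blast
  thus ?thesis by (force simp: bundle_proj_def)
qed

lemma bundle_projE:
  assumes "P \<in> bundle_proj ` bundle_points b c a f"
  obtains X Z u v w where "nondegenerate (X, Z, u, v, w)" "chatelet_eq a f (X, Z, u, v, w)"
    "p1_class X Z = ec_to_p1 P"
proof -
  obtain p where p: "nondegenerate p" "chatelet_eq a f p"
    "surface_to_p1 (bundle_class f p) = ec_to_p1 P"
    using assms by (auto simp: bundle_points_def surface_points_def bundle_proj_def)
  obtain X Z u v w where "p = (X, Z, u, v, w)" by (cases p) auto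
  thus thesis using p that by (simp add: surface_to_p1_bundle_class)
qed

lemma poly_of_rat: "poly (map_poly of_rat q) (of_rat s :: complex) = of_rat (poly q s)"
  by (induction q) (auto simp: map_poly_pCons of_rat_add of_rat_mult)

lemma eval2_of_rat:
  "eval2 p (of_rat s, of_rat t) = of_rat (poly (map_poly (\<lambda>q. poly q s) p) t)"
  unfolding eval2_def
  by (induction p) (auto simp: map_poly_pCons poly_of_rat of_rat_add of_rat_mult)

lemma form_of_of_rat: "form_of f (of_rat X) (of_rat Z) = (of_rat (form_of f X Z) :: complex)"
  by (simp add: form_of_def of_rat_sum of_rat_mult of_rat_power)

lemma chatelet_eq_of_rat:
  "chatelet_eq a f (of_rat X, of_rat Z, of_rat u, of_rat v, of_rat w :: complex)
    \<longleftrightarrow> chatelet_eq a f (X, Z, u, v, w)"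
proof -
  have "of_rat u ^ 2 - of_int a * of_rat v ^ 2 = (of_rat (u ^ 2 - of_int a * v ^ 2) :: complex)"
    by (simp add: of_rat_diff of_rat_mult of_rat_power)
  moreover have "of_rat (form_of f X Z) * of_rat w ^ 2 = (of_rat (form_of f X Z * w ^ 2) :: complex)"
    by (simp add: of_rat_mult of_rat_power)
  ultimately show ?thesis by (simp add: chatelet_eq_def form_of_of_rat)
qed

lemma ec_points_of_rat:
  "P \<in> ec_points b c \<Longrightarrow> (map_ec_point of_rat P :: complex ec_point) \<in> ec_points b c"
  by (cases P)
    (auto simp: ec_points_def simp flip: of_rat_power of_rat_mult of_rat_add)

lemma ec_to_p1_of_rat:
  assumes "p1_class (of_rat X) (of_rat Z) = ec_to_p1 (map_ec_point of_rat P :: complex ec_point)"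
    and "(X, Z) \<noteq> (0, 0)"
  shows "p1_class X Z = ec_to_p1 P"
proof -
  have nz: "(of_rat X :: complex, of_rat Z :: complex) \<noteq> (0, 0)" using assms(2) by simp
  show ?thesis
  proof (cases P)
    case Inf
    thus ?thesis using assms nz by (simp add: p1_class_eq_iff)
  next
    case (Pt x y)
    hence "of_rat X = (of_rat (x * Z) :: complex)"
      using assms nz by (simp add: p1_class_eq_iff of_rat_mult)
    hence "X = x * Z" by (simp only: of_rat_eq_iff)
    thus ?thesis using assms Pt by (simp add: p1_class_eq_iff)
  qed
qed

text \<open>
  Near a rational point a section is given by polynomials with rational coefficients, and the
  chart coordinates of the point are rational as well.  So the values of these polynomials are
  rational homogeneous coordinates of a point of the fibre.
\<close>

lemma rational_points_of_section:
  assumes sec: "is_section b c a f s"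
  shows "ec_points b c \<subseteq> bundle_proj ` (bundle_points b c a f :: (rat ec_point \<times> rat coords set) set)"
proof
  fix P :: "rat ec_point" assume P: "P \<in> ec_points b c"
  let ?P = "map_ec_point of_rat P :: complex ec_point"
  have PC: "?P \<in> ec_points b c" using P by (rule ec_points_of_rat)
  have charts: "\<exists>s t :: rat. st = (of_rat s, of_rat t)"
    if "chart_affine ?P = Some st \<or> chart_inf ?P = Some st" for st
  proof (cases P)
    case Inf
    thus ?thesis using that by (intro exI[of _ 0]) auto
  next
    case (Pt x y)
    hence "st = (of_rat x, of_rat y) \<or> st = (of_rat (x / y), of_rat (1 / y))"
      using that by (auto simp: of_rat_divide split: if_splits)
    thus ?thesis by blast
  qed
  have "regular_in_chart b c f chart_affine (\<lambda>P. snd (s P)) ?P \<or>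
      regular_in_chart b c f chart_inf (\<lambda>P. snd (s P)) ?P"
    using sec PC by (simp add: is_section_def regular_over_rat_def)
  then obtain A st where "chart_affine ?P = Some st \<or> chart_inf ?P = Some st"
    and nd: "nondegenerate (eval_coords A st)"
    and cl: "snd (s ?P) = bundle_class f (eval_coords A st)"
    using PC unfolding regular_in_chart_def by metis
  then obtain s0 t0 where st: "st = (of_rat s0, of_rat t0)" using charts by blast
  obtain A1 A2 A3 A4 A5 where A: "A = (A1, A2, A3, A4, A5)" by (cases A) auto
  define e where "e p = poly (map_poly (\<lambda>q. poly q s0) p) t0" for p :: "rat poly poly"
  let ?q = "(of_rat (e A1), of_rat (e A2), of_rat (e A3), of_rat (e A4), of_rat (e A5)) :: complex coords"
  have q: "eval_coords A st = ?q"
    by (simp add: A st eval_coords_def eval2_of_rat e_def)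
  have sP: "s ?P \<in> bundle_points b c a f" "fst (s ?P) = ?P"
    using sec PC by (auto simp: is_section_def bundle_proj_def)
  then obtain p where p: "chatelet_eq a f p" "snd (s ?P) = bundle_class f p"
    and fib: "surface_to_p1 (snd (s ?P)) = ec_to_p1 ?P"
    unfolding bundle_points_def surface_points_def by (auto simp: case_prod_beta)
  have "?q \<in> bundle_class f p" using cl p(2) mem_bundle_class[of ?q f] q by simp
  hence "chatelet_eq a f (e A1, e A2, e A3, e A4, e A5)"
    using chatelet_eq_bundle_class[OF _ p(1)] chatelet_eq_of_rat by blast
  moreover have nd': "nondegenerate (e A1, e A2, e A3, e A4, e A5)"
    using nd unfolding q by (simp add: nondegenerate_def)
  moreover have "p1_class (of_rat (e A1)) (of_rat (e A2)) = ec_to_p1 ?P"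
    using fib unfolding cl q surface_to_p1_bundle_class .
  hence "p1_class (e A1) (e A2) = ec_to_p1 P"
    using nd' by (intro ec_to_p1_of_rat) (auto simp: nondegenerate_def)
  ultimately show "P \<in> bundle_proj ` bundle_points b c a f" using P by (intro bundle_projI)
qed

section \<open>A conic bundle over the curve \<open>y\<^sup>2 = x\<^sup>3 - 36 x\<close>\<close>

abbreviation quadric :: "rat poly" where "quadric \<equiv> [:4, 5, 1:]"

lemma form_of_quadric: "form_of quadric X Z = (X + Z) * (X + 4 * Z)"
proof -
  have deg: "degree quadric = 2" "half_deg quadric = 1" by (simp_all add: half_deg_def)
  have "form_of quadric X Z = (\<Sum>i\<le>2. of_rat (coeff quadric i) * X ^ i * Z ^ (2 - i))"
    unfolding form_of_def deg by (simp only: mult_1_right)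
  also have "\<dots> = 4 * Z ^ 2 + 5 * X * Z + X ^ 2"
  proof -
    have "{..2::nat} = {0, 1, 2}" by auto
    moreover have "coeff quadric 2 = 1" by (simp add: numeral_2_eq_2)
    ultimately show ?thesis by simp
  qed
  finally show ?thesis by (simp add: algebra_simps power2_eq_square)
qed

text \<open>
  The singular fibres lie over \<open>x = - 1\<close> and \<open>x = - 4\<close>.  At both values \<open>x\<^sup>3 - 36 x\<close> is
  nonzero, so the double cover has two points above each of them.
\<close>

lemma chatelet_data_quadric: "chatelet_data (- 36) 0 (- 1) quadric"
  unfolding chatelet_data_def
proof (intro conjI)
  show "squarefree (- 1 :: int)" by simp
  show "\<nexists>r::rat. r ^ 2 = of_int (- 1)"
    by (metis of_int_minus of_int_1 neg_0_le_iff_le not_one_le_zero zero_le_power2)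
  have q: "map_poly of_rat quadric = ([:4, 5, 1:] :: complex poly)"
    by (simp add: map_poly_pCons)
  show "rsquarefree (map_poly of_rat quadric :: complex poly)"
    unfolding q rsquarefree_roots
  proof (intro allI notI)
    fix z :: complex
    assume "poly [:4, 5, 1:] z = 0 \<and> poly (pderiv [:4, 5, 1:]) z = 0"
    hence z: "4 + z * (5 + z) = 0" "5 + 2 * z = 0" by (auto simp: pderiv_pCons algebra_simps)
    \<comment> \<open>The discriminant of the quadratic is \<open>9\<close>.\<close>
    have "4 * (4 + z * (5 + z)) - (5 + 2 * z) ^ 2 = - 9"
      by (simp add: algebra_simps power2_eq_square)
    thus False unfolding z by simp
  qed
  show "ramification_locus (- 1) quadric \<inter> branch_locus (- 36) 0 = {}"
  proof (rule ccontr)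
    assume "ramification_locus (- 1) quadric \<inter> branch_locus (- 36) 0 \<noteq> {}"
    then obtain X Z where XZ: "(X, Z) \<noteq> (0, 0)" "singular_fibre (- 1) quadric X Z"
      and br: "p1_class X Z \<in> branch_locus (- 36) 0"
      by (auto simp: ramification_locus_def)
    have "form_of quadric X Z = 0" using XZ(2) by (auto simp: singular_fibre_def)
    hence cases: "X = - Z \<or> X = - 4 * Z"
      by (auto simp: form_of_quadric eq_neg_iff_add_eq_0)
    define x :: complex where "x = (if X = - Z then - 1 else - 4)"
    have "X = x * Z" using cases by (auto simp: x_def)
    hence cl: "p1_class x 1 = p1_class X Z" using XZ(1) by (simp add: p1_class_eq_iff)
    define y where "y = csqrt (x ^ 3 - 36 * x)"
    have "y ^ 2 = x ^ 3 - 36 * x" by (simp add: y_def)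
    hence "Pt x y \<in> ec_points (- 36) 0" "Pt x (- y) \<in> ec_points (- 36) 0"
      by (auto simp: ec_points_def of_rat_minus)
    moreover have "ec_to_p1 (Pt x y) = p1_class X Z" "ec_to_p1 (Pt x (- y)) = p1_class X Z"
      using cl by auto
    ultimately have "Pt x y = Pt x (- y)" using br unfolding branch_locus_def by blast
    hence "y = 0" using eq_neg_self_iff by auto
    thus False using \<open>y ^ 2 = x ^ 3 - 36 * x\<close> by (simp add: x_def split: if_splits)
  qed
qed

lemma two_torsion_abscissa:
  fixes x :: "'a::field_char_0"
  assumes "Pt x 0 \<in> ec_points (- 36) 0"
  shows "x = 0 \<or> x = 6 \<or> x = - 6"
proof -
  have "x ^ 3 - 36 * x = 0" using assms by (simp add: ec_points_def of_rat_minus)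
  moreover have "x ^ 3 - 36 * x = x * ((x - 6) * (x + 6))"
    by (simp add: algebra_simps power3_eq_cube)
  ultimately show ?thesis by (auto simp: eq_neg_iff_add_eq_0)
qed

lemma full_two_torsion: "full_rational_two_torsion (- 36) 0"
  unfolding full_rational_two_torsion_def
proof
  fix P :: "complex ec_point"
  assume "P \<in> {P \<in> carrier (ec_group (- 36) 0). P \<otimes>\<^bsub>ec_group (- 36) 0\<^esub> P = \<one>\<^bsub>ec_group (- 36) 0\<^esub>}"
  hence P: "P \<in> ec_points (- 36) 0" and "ec_add (- 36) P P = Inf" by (auto simp: ec_group_def)
  hence neg: "P = ec_neg P" by (simp only: ec_add_eq_Inf_iff)
  show "P \<in> map_ec_point of_rat ` (ec_points (- 36) 0 :: rat ec_point set)"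
  proof (cases P)
    case Inf
    have "map_ec_point of_rat Inf \<in> map_ec_point of_rat ` (ec_points (- 36) 0 :: rat ec_point set)"
      by (rule imageI) (simp add: ec_points_def)
    thus ?thesis using Inf by simp
  next
    case (Pt x y)
    hence y: "y = 0" using neg eq_neg_self_iff by auto
    hence "x = 0 \<or> x = 6 \<or> x = - 6" using P Pt two_torsion_abscissa by blast
    then obtain r :: rat where r: "r = 0 \<or> r = 6 \<or> r = - 6" "x = of_rat r"
      by (metis of_rat_0 of_rat_minus of_rat_numeral_eq)
    have "Pt r 0 \<in> ec_points (- 36) 0" using r(1) by (auto simp: ec_points_def)
    moreover have "P = map_ec_point of_rat (Pt r 0)" using Pt y r(2) by simp
    ultimately show ?thesis by blast
  qed
qed

lemma not_square_rat:
  assumes "0 \<le> m" "m ^ 2 < n" "n < (m + 1) ^ 2"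
  shows "\<not> is_square (of_int n :: rat)"
proof
  assume "is_square (of_int n :: rat)"
  then obtain k where k: "n = k ^ 2"
    using square_of_rat_imp_square_of_int unfolding is_nth_power_def by blast
  have "m ^ 2 < \<bar>k\<bar> ^ 2" "\<bar>k\<bar> ^ 2 < (m + 1) ^ 2" using assms k by simp_all
  hence "m < \<bar>k\<bar>" "\<bar>k\<bar> < m + 1"
    using assms(1) power_less_imp_less_base[of m 2 "\<bar>k\<bar>"]
      power_less_imp_less_base[of "\<bar>k\<bar>" 2 "m + 1"] by linarith+
  thus False by simp
qed

lemma not_square_neg: "x < 0 \<Longrightarrow> \<not> is_square (x :: rat)"
  by (auto simp: is_nth_power_def not_less)

text \<open>
  The point is \<open>(-3, 9)\<close>.  The products of \<open>-3\<close> with the classes \<open>-36, 6, -6\<close> of the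
  \<open>2\<close>-torsion are \<open>108, -18, 18\<close>.
\<close>

lemma positive_rank: "group_rank (ec_group (- 36) 0 :: rat ec_point monoid) > 0"
proof (rule group_rank_positive)
  show P: "Pt (- 3) 9 \<in> (ec_points (- 36) 0 :: rat ec_point set)" by (simp add: ec_points_def)
  fix n :: nat assume n: "n > 0"
  show "Pt (- 3) 9 [^]\<^bsub>ec_group (- 36) 0\<^esub> n \<noteq> (Inf :: rat ec_point)"
  proof (rule infinite_order[OF _ _ P _ _ n])
    show "elliptic_curve (- 36) 0" by (simp add: elliptic_curve_def)
    show "\<not> is_square (sq_class (- 36) (Pt (- 3) 9))" by (simp add: not_square_neg)
    fix T :: "rat ec_point"
    assume T: "T \<in> ec_points (- 36) 0" "T = ec_neg T" "T \<noteq> Inf"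
    obtain x where "T = Pt x 0"
    proof (cases T)
      case (Pt x y)
      hence "y = - y" using T(2) by (metis ec_neg.simps(2) ec_point.inject)
      thus thesis using that Pt eq_neg_self_iff[of y] by simp
    qed (use T(3) in simp)
    moreover from this have "x = 0 \<or> x = 6 \<or> x = - 6" using T(1) two_torsion_abscissa by blast
    ultimately have "sq_class (- 36) T \<in> {- 36, 6, - 6}" by auto
    moreover have "\<not> is_square (of_int 6 :: rat)" by (rule not_square_rat[of 2]) auto
    moreover have "\<not> is_square (of_int 18 :: rat)" by (rule not_square_rat[of 4]) auto
    moreover have "\<not> is_square (of_int 108 :: rat)" by (rule not_square_rat[of 10]) auto
    ultimately show "\<not> is_square (sq_class (- 36) T) \<and>
        \<not> is_square (sq_class (- 36) T * sq_class (- 36) (Pt (- 3) 9))"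
      by (auto simp: not_square_neg)
  qed simp
qed

text \<open>At \<open>x = - 3\<close> the factor \<open>(x + 1) (x + 4)\<close> is \<open>- 2\<close>.\<close>

lemma no_section: "\<nexists>s. is_section (- 36) 0 (- 1) quadric s"
proof
  assume "\<exists>s. is_section (- 36) 0 (- 1) quadric s"
  moreover have "Pt (- 3) 9 \<in> (ec_points (- 36) 0 :: rat ec_point set)"
    by (simp add: ec_points_def)
  ultimately have "Pt (- 3) 9 \<in> (bundle_proj ` bundle_points (- 36) 0 (- 1) quadric :: rat ec_point set)"
    using rational_points_of_section by blast
  then obtain X Z u v w :: rat where nd: "nondegenerate (X, Z, u, v, w)"
    and eq: "chatelet_eq (- 1) quadric (X, Z, u, v, w)" and cl: "p1_class X Z = ec_to_p1 (Pt (- 3) 9)"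
    by (rule bundle_projE)
  have X: "X = - 3 * Z" using nd cl by (auto simp: p1_class_eq_iff nondegenerate_def)
  have "Z \<noteq> 0" using nd X by (auto simp: nondegenerate_def)
  have "u ^ 2 + v ^ 2 = - 2 * (Z * w) ^ 2"
    using eq by (simp add: chatelet_eq_def form_of_quadric X power_mult_distrib power2_eq_square)
  hence "u ^ 2 + v ^ 2 + 2 * (Z * w) ^ 2 = 0" by simp
  hence "u ^ 2 = 0" "v ^ 2 = 0" "(Z * w) ^ 2 = 0"
    using zero_le_power2[of u] zero_le_power2[of v] zero_le_power2[of "Z * w"] by linarith+
  thus False using nd \<open>Z \<noteq> 0\<close> by (simp add: nondegenerate_def)
qed

text \<open>
  The subgroup does not contain \<open>(0, 0)\<close>, whose class \<open>- 36\<close> is negative.  At infinity the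
  conic is \<open>u\<^sup>2 + v\<^sup>2 = w\<^sup>2\<close>, since the quadratic is monic.
\<close>

lemma square_points_lift:
  "square_points (- 36) \<subseteq> bundle_proj ` bundle_points (- 36) 0 (- 1) quadric"
proof
  fix P assume "P \<in> square_points (- 36)"
  hence P: "P \<in> ec_points (- 36) 0" and sq: "is_square (sq_class (- 36) P)"
    by (auto simp: square_points_def)
  show "P \<in> bundle_proj ` bundle_points (- 36) 0 (- 1) quadric"
  proof (cases P)
    case Inf
    show ?thesis
    proof (rule bundle_projI[OF P])
      show "chatelet_eq (- 1) quadric (1, 0, 1, 0, 1 :: rat)"
        by (simp add: chatelet_eq_def form_of_quadric)
    qed (auto simp: Inf nondegenerate_def)
  next
    case (Pt x y)
    have "x \<noteq> 0"
    proof
      assume "x = 0"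
      thus False using sq Pt not_square_neg[of "- 36"] by simp
    qed
    then obtain s where s: "x = s ^ 2" using sq Pt by (auto simp: is_nth_power_def)
    show ?thesis
    proof (rule bundle_projI[OF P])
      show "chatelet_eq (- 1) quadric (s ^ 2, 1, s ^ 2 - 2, 3 * s, 1)"
        by (simp add: chatelet_eq_def form_of_quadric algebra_simps power2_eq_square)
    qed (auto simp: Pt s nondegenerate_def)
  qed
qed

theorem mainTheorem4:
  shows "\<exists>(b::rat) (c::rat) (a::int) (f::rat poly).
    elliptic_curve b c \<and>
    group_rank (ec_group b c :: rat ec_point monoid) > 0 \<and>
    full_rational_two_torsion b c \<and>
    chatelet_data b c a f \<and>
    (\<nexists>s. is_section b c a f s) \<and>
    (\<exists>H P. subgroup H (ec_group b c :: rat ec_point monoid) \<and>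
           finite (rcosets\<^bsub>ec_group b c\<^esub> H) \<and>
           P \<in> carrier (ec_group b c) \<and>
           H #>\<^bsub>ec_group b c\<^esub> P \<subseteq> bundle_proj ` (bundle_points b c a f))"
proof -
  have ec: "elliptic_curve (- 36) 0" by (simp add: elliptic_curve_def)
  have "square_points (- 36) #>\<^bsub>ec_group (- 36) 0\<^esub> Inf = square_points (- 36)"
    by (simp add: r_coset_def ec_group_def)
  hence "square_points (- 36) #>\<^bsub>ec_group (- 36) 0\<^esub> Inf
      \<subseteq> bundle_proj ` bundle_points (- 36) 0 (- 1) quadric"
    using square_points_lift by simp
  moreover have "finite (rcosets\<^bsub>ec_group (- 36) 0\<^esub> (square_points (- 36)))"
    using finite_rcosets_square_points[of "- 36"] ec by simp
  moreover have "subgroup (square_points (- 36)) (ec_group (- 36) 0)"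
    by (rule square_points_subgroup) simp
  moreover have "Inf \<in> carrier (ec_group (- 36) (0::rat) :: rat ec_point monoid)"
    by (simp add: ec_group_def ec_points_def)
  ultimately show ?thesis
    using ec positive_rank full_two_torsion chatelet_data_quadric no_section by metis
qed

end
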